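(* Let $2\le m<\infty$ be the number of crews. The conversion algorithm is the following: take an optimal single-crew repair sequence, treat it as a priority list, and whenever one of the $m$ crews is free, assign to it the next line from the list (the first $m$ lines of the sequence are assigned arbitrarily to the $m$ crews). The conversion algorithm is a $\left(2-\frac1m\right)$-approximation: if $H^m=\sum_{j\in L^D}w_jE^m_j$ is the harm of the $m$-crew schedule it produces and $H^{m,*}$ is the minimal harm over all $m$-crew schedules, then $$H^m\ \le\ \Big(2-\frac1m\Big)H^{m,*}.$$
   Context: Setting: $L^D$ is a finite set of damaged lines of a radial (tree) distribution network with one source; line $l$ has repair time $p_l>0$ and weight $w_l>0$. Lines are directed away from the source. Contracting all nodes joined by intact (undamaged) lines gives a directed rooted tree whose edges are exactly the damaged lines $l=h(l)\to t(l)$ ($w_l$ is the total weight of the network nodes contracted into $t(l)$). The soft precedence graph $P$ has node set $L^D$ and an edge $i\to j$ whenever $t(i)=h(j)$; thus $P$ is a directed forest in which each node has at most one immediate predecessor. Write $i\preceq_S j$ if $i=j$ or there is a directed path from $i$ to $j$ in $P$. An $m$-crew schedule assigns each line $l\in L^D$ to one of $m$ identical crews and a start time $S_l\ge0$; the line is repaired without interruption during $[S_l,S_l+p_l]$, each crew works on at most one line at a time, and $C_l=S_l+p_l$ is the completion time. Soft precedence does not restrict when repairs may start; the energization time is $E_j=\max_{i\preceq_S j}C_i$. The harm of a schedule is $\sum_{j\in L^D}w_jE_j$. A single-crew schedule is represented by a sequence (ordering) of $L^D$, the lines being repaired one after another from time $0$ without idle time; it is optimal if it minimizes the harm. "$\alpha$-approximation"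 means the harm of the constructed schedule is at most $\alpha$ times the minimal harm. *)

theory Defs
  imports Complex_Main "Graph_Theory.Graph_Theory"
begin

section \<open>Radial networks and soft precedence\<close>

text \<open>
  Beware of the clash of conventions: in the library an arc \<open>l\<close> points from
  \<open>tail G l\<close> to \<open>head G l\<close>, whereas in the scheduling literature a line is written
  \<open>l = h(l) \<rightarrow> t(l)\<close>.  So \<open>h(l)\<close> is \<open>tail _ l\<close> and \<open>t(l)\<close> is \<open>head _ l\<close>.
\<close>

locale radial_network = fin_digraph G for G :: "('v, 'l) pre_digraph" +
  fixes source :: 'v
  assumes source_in_verts: "source \<in> verts G"
    and unique_awalk: "\<And>v. v \<in> verts G \<Longrightarrow> \<exists>!q. awalk source q v"

definition intact_network :: "('v, 'l) pre_digraph \<Rightarrow> 'l set \<Rightarrow> ('v, 'l) pre_digraph" where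
  "intact_network G D = G\<lparr>arcs := arcs G - D\<rparr>"

text \<open>The nodes joined to \<open>u\<close> by intact lines, regardless of the direction of the lines.\<close>

definition supernode :: "('v, 'l) pre_digraph \<Rightarrow> 'l set \<Rightarrow> 'v \<Rightarrow> 'v set" where
  "supernode G D u = {v. u \<rightarrow>\<^sup>*\<^bsub>with_proj (mk_symmetric (intact_network G D))\<^esub> v}"

definition contracted_network :: "('v, 'l) pre_digraph \<Rightarrow> 'l set \<Rightarrow> ('v set, 'l) pre_digraph" where
  "contracted_network G D =
    \<lparr> verts = supernode G D ` verts G,
      arcs = D,
      tail = (\<lambda>l. supernode G D (tail G l)),
      head = (\<lambda>l. supernode G D (head G l)) \<rparr>"

definition soft_precedence_graph :: "('v, 'l) pre_digraph \<Rightarrow> 'l set \<Rightarrow> 'l pair_pre_digraph" where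
  "soft_precedence_graph G D =
    \<lparr> pverts = D,
      parcs = {(i, j). i \<in> D \<and> j \<in> D \<and>
        head (contracted_network G D) i = tail (contracted_network G D) j} \<rparr>"

definition soft_precedes :: "('v, 'l) pre_digraph \<Rightarrow> 'l set \<Rightarrow> 'l \<Rightarrow> 'l \<Rightarrow> bool" where
  "soft_precedes G D i j \<longleftrightarrow> i \<rightarrow>\<^sup>*\<^bsub>with_proj (soft_precedence_graph G D)\<^esub> j"

definition line_weight ::
  "('v, 'l) pre_digraph \<Rightarrow> 'l set \<Rightarrow> ('v \<Rightarrow> real) \<Rightarrow> 'l \<Rightarrow> real" where
  "line_weight G D \<omega> l = (\<Sum>v\<in>head (contracted_network G D) l. \<omega> v)"

locale damaged_network = radial_network G source
  for G :: "('v, 'l) pre_digraph" and source :: 'v +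
  fixes D :: "'l set" and \<omega> :: "'v \<Rightarrow> real" and p :: "'l \<Rightarrow> real"
  assumes damaged_subset: "D \<subseteq> arcs G"
    and repair_time_pos: "\<And>l. l \<in> D \<Longrightarrow> p l > 0"
    and line_weight_pos: "\<And>l. l \<in> D \<Longrightarrow> line_weight G D \<omega> l > 0"


section \<open>Harm of a repair plan\<close>

text \<open>In what follows \<open>S l\<close> is the start time of the repair of line \<open>l\<close>.\<close>

definition completion_time :: "('l \<Rightarrow> real) \<Rightarrow> ('l \<Rightarrow> real) \<Rightarrow> 'l \<Rightarrow> real" where
  "completion_time p S l = S l + p l"

definition energization_time ::
  "('v, 'l) pre_digraph \<Rightarrow> 'l set \<Rightarrow> ('l \<Rightarrow> real) \<Rightarrow> ('l \<Rightarrow> real) \<Rightarrow> 'l \<Rightarrow> real" where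
  "energization_time G D p S j = Max {completion_time p S i | i. soft_precedes G D i j}"

definition harm ::
  "('v, 'l) pre_digraph \<Rightarrow> 'l set \<Rightarrow> ('v \<Rightarrow> real) \<Rightarrow> ('l \<Rightarrow> real) \<Rightarrow> ('l \<Rightarrow> real) \<Rightarrow> real" where
  "harm G D \<omega> p S = (\<Sum>j\<in>D. line_weight G D \<omega> j * energization_time G D p S j)"


section \<open>Schedules\<close>

text \<open>The \<open>m\<close> crews are numbered \<open>0, \<dots>, m - 1\<close>; \<open>c l\<close> is the crew repairing line \<open>l\<close>.\<close>

definition is_schedule ::
  "nat \<Rightarrow> 'l set \<Rightarrow> ('l \<Rightarrow> real) \<Rightarrow> ('l \<Rightarrow> nat) \<Rightarrow> ('l \<Rightarrow> real) \<Rightarrow> bool" where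
  "is_schedule m D p c S \<longleftrightarrow>
    (\<forall>l\<in>D. c l < m \<and> 0 \<le> S l) \<and>
    (\<forall>i\<in>D. \<forall>j\<in>D. i \<noteq> j \<and> c i = c j \<longrightarrow>
      completion_time p S i \<le> S j \<or> completion_time p S j \<le> S i)"

definition minimal_harm ::
  "('v, 'l) pre_digraph \<Rightarrow> 'l set \<Rightarrow> ('v \<Rightarrow> real) \<Rightarrow> ('l \<Rightarrow> real) \<Rightarrow> nat \<Rightarrow> real" where
  "minimal_harm G D \<omega> p m = Inf {harm G D \<omega> p S | c S. is_schedule m D p c S}"

definition is_sequence :: "'l set \<Rightarrow> 'l list \<Rightarrow> bool" where
  "is_sequence D xs \<longleftrightarrow> distinct xs \<and> set xs = D"

definition sequence_start :: "('l \<Rightarrow> real) \<Rightarrow> 'l list \<Rightarrow> 'l \<Rightarrow> real" where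
  "sequence_start p xs l = (\<Sum>i\<leftarrow>takeWhile (\<lambda>i. i \<noteq> l) xs. p i)"

definition optimal_sequence ::
  "('v, 'l) pre_digraph \<Rightarrow> 'l set \<Rightarrow> ('v \<Rightarrow> real) \<Rightarrow> ('l \<Rightarrow> real) \<Rightarrow> 'l list \<Rightarrow> bool" where
  "optimal_sequence G D \<omega> p xs \<longleftrightarrow>
    is_arg_min (\<lambda>ys. harm G D \<omega> p (sequence_start p ys)) (is_sequence D) xs"


section \<open>The conversion algorithm\<close>

text \<open>
  \<open>dispatch m p free xs c S\<close> holds if \<open>(c, S)\<close> can result from assigning the lines \<open>xs\<close> in
  list order, where crew \<open>k\<close> is busy until time \<open>free k\<close>.  The next line goes to a crew that
  becomes free first and is started at that moment; ties are broken arbitrarily, which covers the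
  arbitrary assignment of the first \<open>m\<close> lines, when all crews are free at time \<open>0\<close>.
\<close>

fun dispatch ::
  "nat \<Rightarrow> ('l \<Rightarrow> real) \<Rightarrow> (nat \<Rightarrow> real) \<Rightarrow> 'l list \<Rightarrow> ('l \<Rightarrow> nat) \<Rightarrow> ('l \<Rightarrow> real) \<Rightarrow> bool" where
  "dispatch m p free [] c S \<longleftrightarrow> True"
| "dispatch m p free (l # ls) c S \<longleftrightarrow>
    c l < m \<and> (\<forall>k<m. free (c l) \<le> free k) \<and> S l = free (c l) \<and>
    dispatch m p (free(c l := completion_time p S l)) ls c S"

definition conversion_output ::
  "nat \<Rightarrow> ('l \<Rightarrow> real) \<Rightarrow> 'l list \<Rightarrow> ('l \<Rightarrow> nat) \<Rightarrow> ('l \<Rightarrow> real) \<Rightarrow> bool" where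
  "conversion_output m p xs c S \<longleftrightarrow> dispatch m p (\<lambda>_. 0) xs c S"

lemma dispatch_not_before_free:
  assumes "dispatch m p free xs c S" "\<And>l. l \<in> set xs \<Longrightarrow> 0 < p l" "i \<in> set xs"
  shows "c i < m \<and> free (c i) \<le> S i"
  using assms
proof (induction xs arbitrary: free)
  case (Cons l ls)
  show ?case
  proof (cases "i = l")
    case False
    let ?free' = "free(c l := completion_time p S l)"
    have "c i < m \<and> ?free' (c i) \<le> S i"
    proof (rule Cons.IH)
      show "dispatch m p ?free' ls c S"
        using Cons.prems(1) unfolding dispatch.simps by blast
    qed (use Cons.prems False in auto)
    moreover have "free (c i) \<le> ?free' (c i)"
      using Cons.prems(1) Cons.prems(2)[of l] by (auto simp: completion_time_def)
    ultimately show ?thesis by linarith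
  qed (use Cons.prems in auto)
qed simp

lemma dispatch_no_overlap:
  assumes "dispatch m p free xs c S" "\<And>l. l \<in> set xs \<Longrightarrow> 0 < p l"
    and "i \<in> set xs" "j \<in> set xs" "i \<noteq> j" "c i = c j"
  shows "completion_time p S i \<le> S j \<or> completion_time p S j \<le> S i"
  using assms
proof (induction xs arbitrary: free)
  case (Cons l ls)
  let ?free' = "free(c l := completion_time p S l)"
  have d: "dispatch m p ?free' ls c S" and pos: "\<And>l. l \<in> set ls \<Longrightarrow> 0 < p l"
    using Cons.prems(1,2) unfolding dispatch.simps by auto
  consider "i = l" "j \<in> set ls" | "j = l" "i \<in> set ls" | "i \<in> set ls" "j \<in> set ls"
    using Cons.prems by auto
  then show ?case
  proof cases
    case 1
    then show ?thesis
      using dispatch_not_before_free[OF d pos, of j] Cons.prems(6) by auto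
  next
    case 2
    then show ?thesis
      using dispatch_not_before_free[OF d pos, of i] Cons.prems(6) by auto
  next
    case 3
    then show ?thesis using Cons.IH[OF d pos] Cons.prems by blast
  qed
qed simp

lemma conversion_output_is_schedule:
  assumes "is_sequence D xs" "\<And>l. l \<in> D \<Longrightarrow> 0 < p l" "conversion_output m p xs c S"
  shows "is_schedule m D p c S"
  using assms dispatch_not_before_free[of m p "\<lambda>_. 0" xs c S]
    dispatch_no_overlap[of m p "\<lambda>_. 0" xs c S]
  unfolding is_schedule_def conversion_output_def is_sequence_def by auto

end

theory Submission
  imports Defs
begin

text \<open>
  List scheduling never leaves a crew idle while lines are waiting, so in the converted schedule
  \<open>m S\<^sub>l\<close> is at most the single-crew start time of \<open>l\<close>; hence
  \<open>E\<^sub>j \<le> E\<^sup>1\<^sub>j / m + (1 - 1/m) q\<^sub>j\<close>, where \<open>q\<^sub>j\<close> is the largest repair time among the soft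
  predecessors of \<open>j\<close>.  Conversely, let any \<open>m\<close>-crew schedule be given.  Its energization times are
  at least the \<open>q\<^sub>j\<close>.  Moreover, its crews can do at most \<open>m T\<close> units of work until time \<open>T\<close>, so
  repairing the lines with a single crew in the order of their completion multiplies every
  completion time, and hence every energization time, by at most \<open>m\<close>.  Its harm is therefore at
  least \<open>H\<^sup>1 / m\<close>, with \<open>H\<^sup>1\<close> the optimal single-crew harm, and also at least \<open>\<Sum>j. w\<^sub>j q\<^sub>j\<close>.
\<close>

text \<open>Assigning a line raises the sum of all \<open>free k\<close> by exactly its repair time,
  and the chosen crew has the least \<open>free\<close> value, hence at most the mean. The induction
  needs arbitrary \<open>free\<close>; the algorithm starts from zero.\<close>

lemma dispatch_start_le:
  assumes "dispatch m p free xs c S" "l \<in> set xs"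
  shows "real m * S l \<le> (\<Sum>k<m. free k) + sequence_start p xs l"
  using assms
proof (induction xs arbitrary: free)
  case (Cons x xs)
  have cx: "c x < m" "\<forall>k<m. free (c x) \<le> free k" "S x = free (c x)"
    and d: "dispatch m p (free(c x := completion_time p S x)) xs c S"
    using Cons.prems(1) by auto
  show ?case
  proof (cases "l = x")
    case True
    then show ?thesis
      using cx sum_mono[of "{..<m}" "\<lambda>_. free (c x)" free] by (simp add: sequence_start_def)
  next
    case False
    have "(\<Sum>k<m. (free(c x := completion_time p S x)) k)
        = (\<Sum>k<m. free k + (if k = c x then p x else 0))"
      using cx by (intro sum.cong) (auto simp: completion_time_def)
    also have "\<dots> = (\<Sum>k<m. free k) + p x"
      using cx by (simp add: sum.distrib)
    finally show ?thesis
      using Cons.IH[OF d] Cons.prems(2) False by (simp add: sequence_start_def)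
  qed
qed simp

lemma sum_disjoint_jobs_le:
  assumes "finite A"
    and "\<And>i. i \<in> A \<Longrightarrow> 0 < p i \<and> 0 \<le> S i \<and> completion_time p S i \<le> T"
    and "\<And>i j. \<lbrakk>i \<in> A; j \<in> A; i \<noteq> j\<rbrakk> \<Longrightarrow>
      completion_time p S i \<le> S j \<or> completion_time p S j \<le> S i"
    and "0 \<le> T"
  shows "sum p A \<le> T"
  using assms
proof (induction A arbitrary: T rule: finite_ranking_induct[where f = S])
  case (insert x A)
  \<comment> \<open>The induction adds jobs by increasing start, so \<open>x\<close> starts last; as
    \<open>p x > 0\<close>, it cannot end before \<open>i\<close> starts.\<close>
  have "completion_time p S i \<le> S x" if "i \<in> A" "i \<noteq> x" for i
    using insert.prems(2)[of i x] insert.prems(1)[of x] insert.hyps(2)[of i] that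
    by (auto simp: completion_time_def)
  \<comment> \<open>\<open>S x\<close> is the new deadline for the earlier jobs. The induction rule
    also permits \<open>x \<in> A\<close>; then nothing is added and \<open>T\<close> is
    kept.\<close>
  then have "sum p A \<le> S x" if "x \<notin> A"
    using that insert.prems insert.IH[of "S x"] by auto
  moreover have "S x + p x \<le> T"
    using insert.prems(1)[of x] by (simp add: completion_time_def)
  ultimately show ?case
    using insert.hyps(1) insert.IH[of T] insert.prems by (cases "x \<in> A") (auto simp: insert_absorb)
qed simp

lemma is_schedule_work_le:
  assumes "is_schedule m D p c S" "finite D" "\<And>l. l \<in> D \<Longrightarrow> 0 < p l" "0 \<le> T"
  shows "sum p {i \<in> D. completion_time p S i \<le> T} \<le> real m * T"
proof -
  let ?A = "{i \<in> D. completion_time p S i \<le> T}"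
  \<comment> \<open>Group the work by crew: the jobs of one crew are disjoint and lie between 0 and
    \<open>T\<close>.\<close>
  have "sum p ?A = (\<Sum>k<m. sum p {i \<in> ?A. c i = k})"
    using assms by (intro sum.group[symmetric]) (auto simp: is_schedule_def)
  also have "\<dots> \<le> (\<Sum>k<m. T)"
    using assms by (intro sum_mono sum_disjoint_jobs_le[where S = S]) (auto simp: is_schedule_def)
  finally show ?thesis by simp
qed

lemma sequence_completion_le:
  assumes "is_sequence D xs" "finite D" "\<And>i. i \<in> D \<Longrightarrow> 0 < p i" "l \<in> D"
    and "sorted (map f xs)"
  shows "completion_time p (sequence_start p xs) l \<le> sum p {i \<in> D. f i \<le> (f l :: real)}"
proof -
  have xs: "distinct xs" "set xs = D"
    using assms(1) by (auto simp: is_sequence_def)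
  obtain as bs where split: "xs = as @ l # bs" "l \<notin> set as"
    using assms(4) xs split_list_first[of l xs] by blast
  have "takeWhile (\<lambda>i. i \<noteq> l) xs = as"
    using split by (simp add: takeWhile_append)
  then have "completion_time p (sequence_start p xs) l = sum p (insert l (set as))"
    using split xs
    by (simp add: completion_time_def sequence_start_def sum_list_distinct_conv_sum_set)
  \<comment> \<open>Only an inequality, since lines tied with \<open>l\<close> under
    \<open>f\<close> may come later in \<open>xs\<close>.\<close>
  also have "\<dots> \<le> sum p {i \<in> D. f i \<le> f l}"
  proof (rule sum_mono2)
    show "insert l (set as) \<subseteq> {i \<in> D. f i \<le> f l}"
      using assms(4,5) xs(2) split(1) by (auto simp: sorted_append)
  qed (use assms(2,3) in \<open>auto intro: less_imp_le\<close>)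
  finally show ?thesis .
qed

lemma soft_precedes_refl: "j \<in> D \<Longrightarrow> soft_precedes G D j j"
  by (auto simp: soft_precedes_def reachable_def soft_precedence_graph_def)

lemma soft_precedes_in_D:
  assumes "soft_precedes G D i j" shows "i \<in> D"
proof -
  have "wf_digraph (with_proj (soft_precedence_graph G D))"
    by unfold_locales (auto simp: soft_precedence_graph_def)
  then have "i \<in> verts (with_proj (soft_precedence_graph G D))"
    using assms unfolding soft_precedes_def by (rule wf_digraph.reachable_in_verts(1))
  then show ?thesis by (simp add: soft_precedence_graph_def)
qed

text \<open>Makes the \<open>Max\<close> in \<open>energization_time\<close> meaningful, together
  with \<open>soft_precedes_refl\<close> for nonemptiness.\<close>

lemma finite_soft_predecessors: "finite D \<Longrightarrow> finite {F i |i. soft_precedes G D i j}"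
  by (rule finite_subset[of _ "F ` D"]) (auto dest: soft_precedes_in_D)

lemma energization_time_ge:
  assumes "finite D" "soft_precedes G D i j"
  shows "completion_time p S i \<le> energization_time G D p S j"
  unfolding energization_time_def
  using assms by (intro Max_ge finite_soft_predecessors) auto

lemma energization_time_le:
  assumes "finite D" "j \<in> D"
    and "\<And>i. soft_precedes G D i j \<Longrightarrow> completion_time p S i \<le> b"
  shows "energization_time G D p S j \<le> b"
  unfolding energization_time_def
  using assms soft_precedes_refl[of j D G]
  by (subst Max_le_iff) (auto intro: finite_soft_predecessors)

lemma optimal_sequence_harm_le:
  assumes "finite D" "\<And>l. l \<in> D \<Longrightarrow> 0 < p l" "\<And>l. l \<in> D \<Longrightarrow> 0 \<le> line_weight G D \<omega> l"
    and "optimal_sequence G D \<omega> p xs" "is_schedule m D p c S"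
  shows "harm G D \<omega> p (sequence_start p xs) \<le> real m * harm G D \<omega> p S"
proof -
  define ys where "ys = sort_key (completion_time p S) xs"
  have ys: "is_sequence D ys" "sorted (map (completion_time p S) ys)"
    using assms(4) by (auto simp: ys_def optimal_sequence_def is_arg_min_def is_sequence_def)
  have "energization_time G D p (sequence_start p ys) j \<le> real m * energization_time G D p S j"
    if "j \<in> D" for j
  proof (rule energization_time_le[OF assms(1) that])
    fix i assume i: "soft_precedes G D i j"
    then have "i \<in> D" by (rule soft_precedes_in_D)
    then have "0 \<le> completion_time p S i"
      using assms(2)[of i] assms(5) by (auto simp: is_schedule_def completion_time_def)
    \<comment> \<open>Both bounds concern the total repair time of the lines that \<open>S\<close>
      completes no later than \<open>i\<close>.\<close>
    then have "completion_time p (sequence_start p ys) i \<le> real m * completion_time p S i"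
      using sequence_completion_le[OF ys(1) assms(1,2) \<open>i \<in> D\<close> ys(2)]
        is_schedule_work_le[OF assms(5,1,2)] by (meson order_trans)
    also have "\<dots> \<le> real m * energization_time G D p S j"
      using energization_time_ge[OF assms(1) i] by (intro mult_left_mono) auto
    finally show "completion_time p (sequence_start p ys) i \<le> real m * energization_time G D p S j" .
  qed
  then have "harm G D \<omega> p (sequence_start p ys) \<le>
      (\<Sum>j\<in>D. line_weight G D \<omega> j * (real m * energization_time G D p S j))"
    unfolding harm_def using assms(3) by (intro sum_mono mult_left_mono) auto
  also have "\<dots> = real m * harm G D \<omega> p S"
    by (simp add: harm_def sum_distrib_left mult_ac)
  finally show ?thesis
    using assms(4) ys(1) by (fastforce simp: optimal_sequence_def is_arg_min_def)
qed

lemma conversion_energization_le: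
  assumes "finite D" "1 \<le> m" "is_sequence D xs" "conversion_output m p xs c S"
    and "is_schedule m D p c' S'" "j \<in> D"
  shows "energization_time G D p S j \<le>
    energization_time G D p (sequence_start p xs) j / real m
      + (1 - 1 / real m) * energization_time G D p S' j"
proof (rule energization_time_le[OF assms(1,6)])
  fix i assume i: "soft_precedes G D i j"
  let ?s = "sequence_start p xs"
  have "i \<in> D" using i by (rule soft_precedes_in_D)
  then have "real m * S i \<le> ?s i"
    using dispatch_start_le[of m p "\<lambda>_. 0" xs c S i] assms(3,4)
    by (auto simp: conversion_output_def is_sequence_def)
  then have "S i \<le> ?s i / real m"
    using assms(2) by (simp add: field_simps)
  \<comment> \<open>Split \<open>p i\<close> into \<open>p i / m\<close>, which completes the
    single-crew term, and the remaining share \<open>1 - 1/m\<close>.\<close>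
  then have "completion_time p S i
      \<le> completion_time p ?s i / real m + (1 - 1 / real m) * p i"
    using assms(2) by (simp add: completion_time_def field_simps)
  also have "completion_time p ?s i / real m \<le> energization_time G D p ?s j / real m"
    using energization_time_ge[OF assms(1) i] by (intro divide_right_mono) auto
  \<comment> \<open>Starts in \<open>S'\<close> are nonnegative, so \<open>i\<close> alone delays
    \<open>j\<close> by at least \<open>p i\<close>.\<close>
  also have "p i \<le> energization_time G D p S' j"
    using energization_time_ge[OF assms(1) i, of p S'] assms(5) \<open>i \<in> D\<close>
    by (auto simp: is_schedule_def completion_time_def)
  finally show "completion_time p S i \<le> energization_time G D p ?s j / real m
      + (1 - 1 / real m) * energization_time G D p S' j"
    using assms(2) by (simp add: mult_left_mono)
qed

theorem theorem4:
  fixes G :: "('v, 'l) pre_digraph" and source :: 'v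
    and D :: "'l set" and \<omega> :: "'v \<Rightarrow> real" and p :: "'l \<Rightarrow> real"
    and m :: nat and xs :: "'l list" and c :: "'l \<Rightarrow> nat" and S :: "'l \<Rightarrow> real"
  assumes "damaged_network G source D \<omega> p"
    and "2 \<le> m"
    and "optimal_sequence G D \<omega> p xs"
    and "conversion_output m p xs c S"
  shows "harm G D \<omega> p S \<le> (2 - 1 / real m) * minimal_harm G D \<omega> p m"
proof -
  interpret damaged_network G source D \<omega> p by fact
  have fin: "finite D"
    using damaged_subset finite_arcs by (rule finite_subset)
  have seq: "is_sequence D xs"
    using assms(3) by (simp add: optimal_sequence_def is_arg_min_def)
  have w: "0 \<le> line_weight G D \<omega> l" if "l \<in> D" for l
    using line_weight_pos[OF that] by simp
  have pos: "0 < 2 - 1 / real m"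
    using assms(2) by (simp add: field_simps)
  let ?s = "sequence_start p xs"
  have "harm G D \<omega> p S \<le> (2 - 1 / real m) * harm G D \<omega> p S'"
    if "is_schedule m D p c' S'" for c' S'
  proof -
    have "harm G D \<omega> p S \<le> (\<Sum>j\<in>D. line_weight G D \<omega> j *
        (energization_time G D p ?s j / real m
          + (1 - 1 / real m) * energization_time G D p S' j))"
      unfolding harm_def using assms(2)
      by (intro sum_mono mult_left_mono w conversion_energization_le[OF fin _ seq assms(4) that]) auto
    also have "\<dots> = harm G D \<omega> p ?s / real m + (1 - 1 / real m) * harm G D \<omega> p S'"
      by (simp add: harm_def sum_distrib_left sum_divide_distrib flip: sum.distrib)
        (simp add: algebra_simps)
    also have "harm G D \<omega> p ?s / real m \<le> harm G D \<omega> p S'"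
      using optimal_sequence_harm_le[OF fin repair_time_pos w assms(3) that] assms(2)
      by (simp add: field_simps)
    finally show ?thesis by (simp add: algebra_simps)
  qed
  \<comment> \<open>Shows that the set under the infimum is nonempty, as
    \<open>cInf_greatest\<close> demands.\<close>
  moreover have "is_schedule m D p c S"
    using conversion_output_is_schedule[OF seq repair_time_pos assms(4)] .
  ultimately have "harm G D \<omega> p S / (2 - 1 / real m) \<le> minimal_harm G D \<omega> p m"
    unfolding minimal_harm_def using pos
    by (intro cInf_greatest) (auto simp: pos_divide_le_eq mult.commute)
  then show ?thesis
    using pos by (simp add: pos_divide_le_eq mult.commute)
qed

end
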